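(* Let $X$ be a non-empty finite set and let $R:X^2\to X^2$ be a bijection. (i) $R$ is non-degenerate if and only if its $n$th level $R^{n,n}$ is non-degenerate for every $n\ge1$. (ii) $R$ is a non-degenerate solution of the Yang–Baxter equation on $X$ if and only if $R^{n,n}$ is a non-degenerate solution of the Yang–Baxter equation on $X^n$ for every $n\ge1$.
   Context: A bijection $R:Y^2\to Y^2$ is a (set-theoretic) solution of the Yang–Baxter equation on $Y$ if $R_{12}R_{23}R_{12}=R_{23}R_{12}R_{23}$ on $Y^3$, where $R_{12}=R\times\mathrm{id}_Y$, $R_{23}=\mathrm{id}_Y\times R$. Writing $R(x,y)=(u,v)$, $R$ is non-degenerate if $x\mapsto v$ is a bijection of $Y$ for each fixed $y$ and $y\mapsto u$ is a bijection of $Y$ for each fixed $x$. Higher levels: identify $X^n$ with the set of words of length $n$ in the alphabet $X$. For words $u,v\in X^n$, $R^{n,n}(u,v)=(v',u')$ is defined by moving $u$ past $v$ letter by letter using $R$, i.e. by $e^1_ue^2_v=e^2_{v'}e^1_{u'}$ in the unital semigroup generated by $e^1_{\mathfrak s},e^2_{\mathfrak s}$ ($\mathfrak s\in X$) subject to $e^1_{\mathfrak s}e^2_{\mathfrak t}=e^2_{\mathfrak t'}e^1_{\mathfrak s'}$ whenever $R(\mathfrak s,\mathfrak t)=(\mathfrak t',\mathfrak s')$, where $e^i_u=e^i_{\mathfrak s_1}\cdots e^i_{\mathfrak s_n}$ for $u=\mathfrak s_1\cdots\mathfrak s_n$. Explicitly, identifying $X^n\times X^n$ with $X^{2n}$ by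 concatenation, $$R^{n,n}=(R_{n,n+1}\cdots R_{12})(R_{n+1,n+2}\cdots R_{23})\cdots(R_{2n-1,2n}\cdots R_{n,n+1}),$$ where $R_{i,i+1}$ applies $R$ to the coordinates $i,i+1$ and fixes the others, and products denote composition of maps (rightmost applied first). *)

theory Defs
  imports Main
begin

text \<open>
  A map on a set \<open>Y\<close> is represented by a HOL function on the ambient type, whose values
  outside \<open>Y\<close> are irrelevant.  A pair \<open>R (x, y) = (u, v)\<close> has \<open>u = fst (R (x, y))\<close> and
  \<open>v = snd (R (x, y))\<close>; triples are the nested pairs \<open>(x, (y, z))\<close>.
\<close>

definition R12 :: "('b \<times> 'b \<Rightarrow> 'b \<times> 'b) \<Rightarrow> 'b \<times> 'b \<times> 'b \<Rightarrow> 'b \<times> 'b \<times> 'b" where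
  "R12 R = (\<lambda>(x, y, z). (fst (R (x, y)), snd (R (x, y)), z))"

definition R23 :: "('b \<times> 'b \<Rightarrow> 'b \<times> 'b) \<Rightarrow> 'b \<times> 'b \<times> 'b \<Rightarrow> 'b \<times> 'b \<times> 'b" where
  "R23 R = (\<lambda>(x, y, z). (x, fst (R (y, z)), snd (R (y, z))))"

definition yb_solution :: "'b set \<Rightarrow> ('b \<times> 'b \<Rightarrow> 'b \<times> 'b) \<Rightarrow> bool" where
  "yb_solution Y R \<longleftrightarrow>
     bij_betw R (Y \<times> Y) (Y \<times> Y) \<and>
     (\<forall>t \<in> Y \<times> Y \<times> Y.
        (R12 R \<circ> R23 R \<circ> R12 R) t = (R23 R \<circ> R12 R \<circ> R23 R) t)"

definition nondegenerate :: "'b set \<Rightarrow> ('b \<times> 'b \<Rightarrow> 'b \<times> 'b) \<Rightarrow> bool" where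
  "nondegenerate Y R \<longleftrightarrow>
     (\<forall>y \<in> Y. bij_betw (\<lambda>x. snd (R (x, y))) Y Y) \<and>
     (\<forall>x \<in> Y. bij_betw (\<lambda>y. fst (R (x, y))) Y Y)"

definition words :: "'a set \<Rightarrow> nat \<Rightarrow> 'a list set" where
  "words X n = {w. set w \<subseteq> X \<and> length w = n}"

text \<open>
  \<open>R_at R i\<close> is $R_{i,i+1}$ on words.  The index \<open>i \<ge> 1\<close> counts coordinates from one, so
  coordinates \<open>i\<close> and \<open>i + 1\<close> are the list entries \<open>i - 1\<close> and \<open>i\<close>.
\<close>

definition R_at :: "('a \<times> 'a \<Rightarrow> 'a \<times> 'a) \<Rightarrow> nat \<Rightarrow> 'a list \<Rightarrow> 'a list" where
  "R_at R i w =
     w[i - 1 := fst (R (w ! (i - 1), w ! i)), i := snd (R (w ! (i - 1), w ! i))]"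

text \<open>Composition $f_1 \circ \cdots \circ f_m$ of a list of maps; the last one is applied first.\<close>

definition compose_list :: "('b \<Rightarrow> 'b) list \<Rightarrow> 'b \<Rightarrow> 'b" where
  "compose_list fs = foldr (\<circ>) fs id"

text \<open>
  The \<open>k\<close>-th factor below is $R_{n+k-1,n+k} \cdots R_{k,k+1}$, for \<open>k = 1, \<dots>, n\<close>, so that
  \<open>level_word R n\<close> is
  $(R_{n,n+1} \cdots R_{12})(R_{n+1,n+2} \cdots R_{23}) \cdots (R_{2n-1,2n} \cdots R_{n,n+1})$
  on words of length \<open>2n\<close>.
\<close>

definition level_word :: "('a \<times> 'a \<Rightarrow> 'a \<times> 'a) \<Rightarrow> nat \<Rightarrow> 'a list \<Rightarrow> 'a list" where
  "level_word R n =
     compose_list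
       (map (\<lambda>k. compose_list (map (R_at R) (rev [k..<n + k]))) [1..<n + 1])"

definition level :: "('a \<times> 'a \<Rightarrow> 'a \<times> 'a) \<Rightarrow> nat \<Rightarrow> 'a list \<times> 'a list \<Rightarrow> 'a list \<times> 'a list" where
  "level R n = (\<lambda>(u, v). (take n (level_word R n (u @ v)), drop n (level_word R n (u @ v))))"

end

theory Submission
  imports Defs
begin

text \<open>
  Moving the word \<open>u\<close> past the word \<open>v\<close> produces a word \<open>word_front R u v\<close> of the length of \<open>v\<close>,
  followed by a word \<open>word_back R u v\<close> of the length of \<open>u\<close>, and \<open>level R n (u, v)\<close> is this pair when
  both words have length \<open>n\<close> (\<open>level_eq\<close>).  Both words are given by structural recursions that
  make sense for words of any two lengths, and everything is proved in that generality.

  Non-degeneracy passes to words because \<open>u \<mapsto> word_back R u v\<close> is triangular: the last letter of \<open>u\<close>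
  meets the unchanged word \<open>v\<close>, so it is determined by the last letter of the result; once it is
  known, so is the word which the preceding letter meets, and so on.  In the same way, for fixed
  \<open>u\<close>, the map \<open>v \<mapsto> word_front R u v\<close> is a composition of maps, one for each letter of \<open>u\<close>, that are
  triangular starting from the first letter.  This gives injectivity, and bijectivity follows
  since the set of words of a given length is finite.

  For the Yang--Baxter equation, moving words is compatible with concatenation on either side
  (\<open>word_front_append_left\<close> and its companions; these are the hexagon identities of a braiding).
  In a picture of strands, this is the replacement of one strand by a bundle of parallel strands,
  and a triple crossing of bundles can be performed by moving one strand at a time through the
  crossing of the two other bundles.  Thus the equation for three words follows from the one for
  three letters by inducting on the three words one after the other.

  Both converse implications are the case \<open>n = 1\<close>, where the level is \<open>R\<close> on one-letter words.
\<close>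

section \<open>Moving a word past a word\<close>

primrec letter_front :: "('a \<times> 'a \<Rightarrow> 'a \<times> 'a) \<Rightarrow> 'a list \<Rightarrow> 'a \<Rightarrow> 'a list" where
  "letter_front R [] s = []"
| "letter_front R (t # v) s = fst (R (s, t)) # letter_front R v (snd (R (s, t)))"

primrec letter_back :: "('a \<times> 'a \<Rightarrow> 'a \<times> 'a) \<Rightarrow> 'a list \<Rightarrow> 'a \<Rightarrow> 'a" where
  "letter_back R [] s = s"
| "letter_back R (t # v) s = letter_back R v (snd (R (s, t)))"

primrec word_front :: "('a \<times> 'a \<Rightarrow> 'a \<times> 'a) \<Rightarrow> 'a list \<Rightarrow> 'a list \<Rightarrow> 'a list" where
  "word_front R [] v = v"
| "word_front R (s # u) v = letter_front R (word_front R u v) s"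

primrec word_back :: "('a \<times> 'a \<Rightarrow> 'a \<times> 'a) \<Rightarrow> 'a list \<Rightarrow> 'a list \<Rightarrow> 'a list" where
  "word_back R [] v = []"
| "word_back R (s # u) v = letter_back R (word_front R u v) s # word_back R u v"

lemma length_letter_front [simp]: "length (letter_front R v s) = length v"
  by (induction v arbitrary: s) auto

lemma length_word_front [simp]: "length (word_front R u v) = length v"
  by (induction u) auto

lemma length_word_back [simp]: "length (word_back R u v) = length u"
  by (induction u) auto

lemma letter_closed:
  assumes R: "R ` (X \<times> X) \<subseteq> X \<times> X" and "s \<in> X" and "set v \<subseteq> X"
  shows "set (letter_front R v s) \<subseteq> X" and "letter_back R v s \<in> X"
proof -
  have step: "fst (R (a, b)) \<in> X \<and> snd (R (a, b)) \<in> X" if "a \<in> X" "b \<in> X" for a b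
    using R that by (auto simp: image_subset_iff mem_Times_iff)
  have "set (letter_front R v s) \<subseteq> X \<and> letter_back R v s \<in> X"
    using assms(2,3) by (induction v arbitrary: s) (auto simp: step)
  then show "set (letter_front R v s) \<subseteq> X" and "letter_back R v s \<in> X" by auto
qed

lemma word_front_closed:
  assumes "R ` (X \<times> X) \<subseteq> X \<times> X" and "set u \<subseteq> X" and "set v \<subseteq> X"
  shows "set (word_front R u v) \<subseteq> X"
  using assms(2) by (induction u) (simp_all add: assms(3) letter_closed(1)[OF assms(1)])

lemma word_back_closed:
  assumes "R ` (X \<times> X) \<subseteq> X \<times> X" and "set u \<subseteq> X" and "set v \<subseteq> X"
  shows "set (word_back R u v) \<subseteq> X"
  using assms(2) by (induction u)
    (simp_all add: assms(3) letter_closed(2)[OF assms(1)] word_front_closed[OF assms(1)])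

section \<open>The explicit formula for the level\<close>

lemma R_at_append:
  "R_at R (Suc (length p)) (p @ s # t # q) = p @ fst (R (s, t)) # snd (R (s, t)) # q"
  by (simp add: R_at_def nth_append list_update_append)

lemma compose_list_simps [simp]:
  "compose_list [] = id"
  "compose_list (f # fs) = f \<circ> compose_list fs"
  by (simp_all add: compose_list_def)

lemma compose_list_append: "compose_list (fs @ gs) = compose_list fs \<circ> compose_list gs"
  by (induction fs) (auto simp: comp_assoc)

text \<open>
  One factor of the formula for the level moves the letter in position \<open>length p + 1\<close> to the
  right, past a word \<open>v\<close>; the words \<open>p\<close> and \<open>q\<close> are spectators.
\<close>

lemma factor_moves_letter:
  "compose_list (map (R_at R) (rev [Suc (length p)..<length v + Suc (length p)])) (p @ s # v @ q)
     = p @ letter_front R v s @ letter_back R v s # q"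
proof (induction v arbitrary: p s)
  case Nil
  then show ?case by simp
next
  case (Cons t v)
  have "[Suc (length p)..<length (t # v) + Suc (length p)]
      = Suc (length p) # [Suc (Suc (length p))..<length v + Suc (Suc (length p))]"
    by (subst upt_conv_Cons) simp_all
  then show ?case
    using Cons.IH[of "p @ [fst (R (s, t))]" "snd (R (s, t))"]
    by (simp add: compose_list_append R_at_append del: upt_Suc)
qed

lemma factors_move_word:
  "compose_list (map (\<lambda>k. compose_list (map (R_at R) (rev [k..<length v + k])))
       [Suc (length p)..<length u + Suc (length p)]) (p @ u @ v)
     = p @ word_front R u v @ word_back R u v"
proof (induction u arbitrary: p)
  case Nil
  then show ?case by simp
next
  case (Cons s u)
  have "[Suc (length p)..<length (s # u) + Suc (length p)]
      = Suc (length p) # [Suc (Suc (length p))..<length u + Suc (Suc (length p))]"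
    by (subst upt_conv_Cons) simp_all
  then show ?case
    using Cons.IH[of "p @ [s]"]
      factor_moves_letter[of R p "word_front R u v" s "word_back R u v"]
    by (simp del: upt_Suc)
qed

lemma level_eq:
  assumes "length u = n" and "length v = n"
  shows "level R n (u, v) = (word_front R u v, word_back R u v)"
  using factors_move_word[of R v "[]" u] assms
  by (simp add: level_def level_word_def del: upt_Suc)

section \<open>Non-degeneracy and bijectivity\<close>

text \<open>
  The crossings can be undone from the last one back to the first: the letter that leaves the
  word and the last letter of the front determine, as \<open>R\<close> is injective, the last letter of \<open>v\<close> and
  the letter that arrived there.
\<close>

lemma letter_joint_inj:
  assumes "inj_on R (X \<times> X)" and "R ` (X \<times> X) \<subseteq> X \<times> X"
    and "length v = length v'" and "s \<in> X" "s' \<in> X" "set v \<subseteq> X" "set v' \<subseteq> X"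
    and "letter_front R v s = letter_front R v' s'" and "letter_back R v s = letter_back R v' s'"
  shows "s = s' \<and> v = v'"
  using assms(3-)
proof (induction v v' arbitrary: s s' rule: list_induct2)
  case Nil
  then show ?case by simp
next
  case (Cons t v t' v')
  have "R (s, t) \<in> X \<times> X" "R (s', t') \<in> X \<times> X"
    using Cons.prems assms(2) by auto
  then have "snd (R (s, t)) = snd (R (s', t')) \<and> v = v'"
    using Cons.prems by (intro Cons.IH) auto
  moreover from this have "R (s, t) = R (s', t')"
    using Cons.prems by (intro prod_eqI) auto
  ultimately show ?case
    using assms(1) Cons.prems by (auto dest: inj_onD)
qed

lemma word_joint_inj:
  assumes "inj_on R (X \<times> X)" and "R ` (X \<times> X) \<subseteq> X \<times> X"
    and "length u = length u'" and "length v = length v'"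
    and "set u \<subseteq> X" "set u' \<subseteq> X" "set v \<subseteq> X" "set v' \<subseteq> X"
    and "word_front R u v = word_front R u' v'" and "word_back R u v = word_back R u' v'"
  shows "u = u' \<and> v = v'"
  using assms(3,5,6,9,10)
proof (induction u u' rule: list_induct2)
  case Nil
  then show ?case by simp
next
  case (Cons s u s' u')
  have "s = s' \<and> word_front R u v = word_front R u' v'"
    using Cons.prems assms by (intro letter_joint_inj[of R X]) (simp_all add: word_front_closed)
  then show ?case
    using Cons by auto
qed

text \<open>
  For a fixed word \<open>v\<close>, moving past \<open>v\<close> is a composition of the injective maps
  \<open>s \<mapsto> snd (R (s, t))\<close> for the letters \<open>t\<close> of \<open>v\<close>.
\<close>

lemma letter_back_inj:
  assumes "\<forall>t\<in>X. inj_on (\<lambda>s. snd (R (s, t))) X" and "R ` (X \<times> X) \<subseteq> X \<times> X"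
    and "s \<in> X" "s' \<in> X" "set v \<subseteq> X" and "letter_back R v s = letter_back R v s'"
  shows "s = s'"
  using assms(3-)
proof (induction v arbitrary: s s')
  case Nil
  then show ?case by simp
next
  case (Cons t v)
  have "R (s, t) \<in> X \<times> X" "R (s', t) \<in> X \<times> X"
    using Cons.prems assms(2) by auto
  then have "snd (R (s, t)) = snd (R (s', t))"
    using Cons.prems by - (rule Cons.IH, auto)
  then show ?case
    using assms(1) Cons.prems by (auto dest: inj_onD)
qed

text \<open>
  The step from \<open>u\<close> to \<open>s # u\<close> is the triangular one: \<open>s\<close> meets the word \<open>word_front R u v\<close>,
  which is known as soon as \<open>u\<close> is.
\<close>

lemma word_back_inj:
  assumes "\<forall>t\<in>X. inj_on (\<lambda>s. snd (R (s, t))) X" and "R ` (X \<times> X) \<subseteq> X \<times> X"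
    and "length u = length u'" and "set u \<subseteq> X" "set u' \<subseteq> X" "set v \<subseteq> X"
    and "word_back R u v = word_back R u' v"
  shows "u = u'"
  using assms(3,4,5,7)
proof (induction u u' rule: list_induct2)
  case Nil
  then show ?case by simp
next
  case (Cons s u s' u')
  then have "u = u'" by simp
  moreover from this have "s = s'"
    using Cons.prems assms
    by - (rule letter_back_inj[of X R s s' "word_front R u v"],
        simp_all add: word_front_closed)
  ultimately show ?case by simp
qed

text \<open>
  The first letter of the result determines the first letter of \<open>v\<close>, hence also the letter that
  meets the rest of \<open>v\<close>.
\<close>

lemma letter_front_inj:
  assumes "\<forall>s\<in>X. inj_on (\<lambda>t. fst (R (s, t))) X" and "R ` (X \<times> X) \<subseteq> X \<times> X"
    and "length v = length v'" and "s \<in> X" "set v \<subseteq> X" "set v' \<subseteq> X"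
    and "letter_front R v s = letter_front R v' s"
  shows "v = v'"
  using assms(3-)
proof (induction v v' arbitrary: s rule: list_induct2)
  case Nil
  then show ?case by simp
next
  case (Cons t v t' v')
  then have "t = t'"
    using assms(1) by (auto dest: inj_onD)
  have "R (s, t) \<in> X \<times> X"
    using Cons.prems assms(2) by auto
  then have "v = v'"
    using Cons.prems \<open>t = t'\<close> by - (rule Cons.IH[of "snd (R (s, t))"], auto)
  with \<open>t = t'\<close> show ?case by simp
qed

lemma word_front_inj:
  assumes "\<forall>s\<in>X. inj_on (\<lambda>t. fst (R (s, t))) X" and "R ` (X \<times> X) \<subseteq> X \<times> X"
    and "length v = length v'" and "set u \<subseteq> X" "set v \<subseteq> X" "set v' \<subseteq> X"
    and "word_front R u v = word_front R u v'"
  shows "v = v'"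
  using assms(4,7)
proof (induction u)
  case Nil
  then show ?case by simp
next
  case (Cons s u)
  have "word_front R u v = word_front R u v'"
    using Cons.prems assms
    by - (rule letter_front_inj[of X R _ _ s], simp_all add: word_front_closed)
  then show ?case
    using Cons by simp
qed

lemma finite_words: "finite X \<Longrightarrow> finite (words X n)"
  unfolding words_def by (rule finite_lists_length_eq)

lemma level_closed:
  assumes "R ` (X \<times> X) \<subseteq> X \<times> X"
  shows "level R n ` (words X n \<times> words X n) \<subseteq> words X n \<times> words X n"
  by (clarsimp simp: words_def level_eq word_front_closed[OF assms] word_back_closed[OF assms])

lemma bij_level:
  assumes "finite X" and R: "bij_betw R (X \<times> X) (X \<times> X)"
  shows "bij_betw (level R n) (words X n \<times> words X n) (words X n \<times> words X n)"
proof -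
  have inj: "inj_on R (X \<times> X)" and im: "R ` (X \<times> X) \<subseteq> X \<times> X"
    using R by (auto simp: bij_betw_def)
  have "inj_on (level R n) (words X n \<times> words X n)"
  proof (rule inj_onI, clarify)
    fix u v u' v'
    assume "u \<in> words X n" "v \<in> words X n" "u' \<in> words X n" "v' \<in> words X n"
      and "level R n (u, v) = level R n (u', v')"
    then show "u = u' \<and> v = v'"
      by (intro word_joint_inj[OF inj im]) (auto simp: words_def level_eq)
  qed
  then show ?thesis
    using endo_inj_surj[OF _ level_closed[OF im]] assms(1)
    by (simp add: bij_betw_def finite_words)
qed

text \<open>
  An injective map of a finite set to itself is onto, which spares the construction of inverse
  maps on words.
\<close>

lemma nondegenerate_iff_inj:
  assumes "finite Y" and "R ` (Y \<times> Y) \<subseteq> Y \<times> Y"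
  shows "nondegenerate Y R \<longleftrightarrow>
    (\<forall>y\<in>Y. inj_on (\<lambda>x. snd (R (x, y))) Y) \<and> (\<forall>x\<in>Y. inj_on (\<lambda>y. fst (R (x, y))) Y)"
proof -
  have bij: "bij_betw f Y Y \<longleftrightarrow> inj_on f Y" if "f ` Y \<subseteq> Y" for f
    using endo_inj_surj[OF assms(1) that] by (auto simp: bij_betw_def)
  have "(\<lambda>x. snd (R (x, y))) ` Y \<subseteq> Y" "(\<lambda>x. fst (R (y, x))) ` Y \<subseteq> Y" if "y \<in> Y" for y
    using assms(2) that by (auto simp: image_subset_iff mem_Times_iff)
  then show ?thesis
    by (simp add: nondegenerate_def bij)
qed

lemma nondegenerate_level:
  assumes "finite X" and im: "R ` (X \<times> X) \<subseteq> X \<times> X" and "nondegenerate X R"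
  shows "nondegenerate (words X n) (level R n)"
proof -
  have "\<forall>t\<in>X. inj_on (\<lambda>s. snd (R (s, t))) X" and "\<forall>s\<in>X. inj_on (\<lambda>t. fst (R (s, t))) X"
    using assms nondegenerate_iff_inj[OF assms(1,2)] by auto
  note injs = word_back_inj[OF this(1) im] word_front_inj[OF this(2) im]
  show ?thesis
    unfolding nondegenerate_iff_inj[OF finite_words[OF assms(1)] level_closed[OF im]]
  proof (intro conjI ballI inj_onI)
    fix u u' v
    assume "u \<in> words X n" "u' \<in> words X n" "v \<in> words X n"
    then show "snd (level R n (u, v)) = snd (level R n (u', v)) \<Longrightarrow> u = u'"
      and "fst (level R n (v, u)) = fst (level R n (v, u')) \<Longrightarrow> u = u'"
      using injs(1)[of u u' v] injs(2)[of u u' v] by (simp_all add: words_def level_eq)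
  qed
qed

section \<open>Compatibility with concatenation\<close>

text \<open>
  The recursion for words runs over the word that moves, so it gives the behaviour of a
  concatenation on the left directly, whereas a concatenation on the right is first treated for a
  single moving letter.
\<close>

lemma word_front_append_left: "word_front R (u @ u') v = word_front R u (word_front R u' v)"
  by (induction u) auto

lemma word_back_append_left:
  "word_back R (u @ u') v = word_back R u (word_front R u' v) @ word_back R u' v"
  by (induction u) (auto simp: word_front_append_left)

lemma letter_append_right:
  "letter_front R (v @ v') s = letter_front R v s @ letter_front R v' (letter_back R v s)"
  "letter_back R (v @ v') s = letter_back R v' (letter_back R v s)"
  by (induction v arbitrary: s) auto

lemma word_front_append_right:
  "word_front R u (v @ v') = word_front R u v @ word_front R (word_back R u v) v'"
  by (induction u) (auto simp: letter_append_right)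

lemma word_back_append_right: "word_back R u (v @ v') = word_back R (word_back R u v) v'"
  by (induction u) (auto simp: letter_append_right word_front_append_right)

lemma word_front_Nil [simp]: "word_front R u [] = []"
  by (induction u) auto

lemma word_back_Nil [simp]: "word_back R u [] = u"
  by (induction u) auto

section \<open>The Yang--Baxter equation for words\<close>

text \<open>
  This is the Yang--Baxter equation at the triple \<open>(x, y, z)\<close>, written coordinate by coordinate so
  that it makes sense for words of three different lengths, which the inductions below require.
\<close>

definition yb_words :: "('a \<times> 'a \<Rightarrow> 'a \<times> 'a) \<Rightarrow> 'a list \<Rightarrow> 'a list \<Rightarrow> 'a list \<Rightarrow> bool" where
  "yb_words R x y z \<longleftrightarrow>
     word_front R (word_front R x y) (word_front R (word_back R x y) z) =
       word_front R x (word_front R y z) \<and>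
     word_back R (word_front R x y) (word_front R (word_back R x y) z) =
       word_front R (word_back R x (word_front R y z)) (word_back R y z) \<and>
     word_back R (word_back R x y) z =
       word_back R (word_back R x (word_front R y z)) (word_back R y z)"

text \<open>
  If one of the three words is a concatenation, the triple crossing of the bundles is a succession
  of two triple crossings.  A word that has crossed the other part of the concatenation before it
  enters one of them appears there as changed by that crossing.
\<close>

lemma yb_words_append_1:
  assumes "yb_words R x' y z"
    and "yb_words R x (word_front R x' y) (word_front R (word_back R x' y) z)"
  shows "yb_words R (x @ x') y z"
  using assms
  by (simp add: yb_words_def word_front_append_left word_back_append_left
      word_front_append_right word_back_append_right)

lemma yb_words_append_2:
  assumes "yb_words R x y (word_front R y' z)" and "yb_words R (word_back R x y) y' z"
  shows "yb_words R x (y @ y') z"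
  using assms
  by (simp add: yb_words_def word_front_append_left word_back_append_left
      word_front_append_right word_back_append_right)

lemma yb_words_append_3:
  assumes "yb_words R x y z"
    and "yb_words R (word_back R x (word_front R y z)) (word_back R y z) z'"
  shows "yb_words R x y (z @ z')"
  using assms
  by (simp add: yb_words_def word_front_append_left word_back_append_left
      word_front_append_right word_back_append_right)

lemma yb_words_Nil [simp]: "yb_words R [] y z" "yb_words R x [] z" "yb_words R x y []"
  by (simp_all add: yb_words_def)

lemma yb_words_letters:
  "yb_words R [x] [y] [z] \<longleftrightarrow>
     (R12 R \<circ> R23 R \<circ> R12 R) (x, y, z) = (R23 R \<circ> R12 R \<circ> R23 R) (x, y, z)"
  by (simp add: yb_words_def R12_def R23_def prod_eq_iff split_beta)

text \<open>
  The three inductions split off one letter at a time, from the third word, then from the second,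
  then from the first.  The words not yet reached stay of length one, but their letters change
  under the crossings, which is why the statements \<open>third\<close> and \<open>second\<close> quantify over them.
\<close>

lemma yb_words_of_letters:
  assumes im: "R ` (X \<times> X) \<subseteq> X \<times> X"
    and letters: "\<And>x y z. x \<in> X \<Longrightarrow> y \<in> X \<Longrightarrow> z \<in> X \<Longrightarrow> yb_words R [x] [y] [z]"
    and "set x \<subseteq> X" "set y \<subseteq> X" "set z \<subseteq> X"
  shows "yb_words R x y z"
proof -
  have single: "\<exists>a\<in>X. w = [a]" if "set w \<subseteq> X" "length w = 1" for w
    using that by (cases w) auto
  note closed = word_front_closed[OF im] word_back_closed[OF im]
  have third: "yb_words R x y z"
    if "set x \<subseteq> X" "length x = 1" "set y \<subseteq> X" "length y = 1" "set z \<subseteq> X" for x y z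
    using that
  proof (induction z arbitrary: x y)
    case Nil
    then show ?case by simp
  next
    case (Cons c z)
    have "yb_words R x y [c]"
      using single[of x] single[of y] Cons.prems letters by auto
    moreover have "yb_words R (word_back R x (word_front R y [c])) (word_back R y [c]) z"
      using Cons.prems by (intro Cons.IH) (simp_all add: closed)
    ultimately show ?case
      using yb_words_append_3[of R x y "[c]" z] by simp
  qed
  have second: "yb_words R x y z"
    if "set x \<subseteq> X" "length x = 1" "set y \<subseteq> X" "set z \<subseteq> X" for x y z
    using that
  proof (induction y arbitrary: x)
    case Nil
    then show ?case by simp
  next
    case (Cons b y)
    have "yb_words R x [b] (word_front R y z)"
      using Cons.prems by (intro third) (simp_all add: closed)
    moreover have "yb_words R (word_back R x [b]) y z"
      using Cons.prems by (intro Cons.IH) (simp_all add: closed)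
    ultimately show ?case
      using yb_words_append_2[of R x "[b]" y z] by simp
  qed
  show ?thesis
    using assms(3)
  proof (induction x)
    case Nil
    then show ?case by simp
  next
    case (Cons a x)
    have "yb_words R [a] (word_front R x y) (word_front R (word_back R x y) z)"
      using Cons.prems assms by (intro second) (simp_all add: closed)
    then show ?case
      using yb_words_append_1[of R x y z "[a]"] Cons by simp
  qed
qed

lemma level_yb_iff:
  assumes "x \<in> words X n" "y \<in> words X n" "z \<in> words X n"
  shows "(R12 (level R n) \<circ> R23 (level R n) \<circ> R12 (level R n)) (x, y, z)
      = (R23 (level R n) \<circ> R12 (level R n) \<circ> R23 (level R n)) (x, y, z) \<longleftrightarrow> yb_words R x y z"
  using assms by (simp add: words_def R12_def R23_def level_eq yb_words_def prod_eq_iff split_beta)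

lemma yb_solution_level:
  assumes "finite X" and yb: "yb_solution X R"
  shows "yb_solution (words X n) (level R n)"
proof -
  have R: "bij_betw R (X \<times> X) (X \<times> X)"
    and letters: "\<And>x y z. x \<in> X \<Longrightarrow> y \<in> X \<Longrightarrow> z \<in> X \<Longrightarrow> yb_words R [x] [y] [z]"
    using yb by (simp_all add: yb_solution_def yb_words_letters del: o_apply)
  have "yb_words R x y z" if "x \<in> words X n" "y \<in> words X n" "z \<in> words X n" for x y z
    using R that yb_words_of_letters[of R X x y z, OF _ letters]
    by (simp add: bij_betw_def words_def)
  then show ?thesis
    using bij_level[OF assms(1) R] by (simp add: yb_solution_def level_yb_iff del: o_apply)
qed

section \<open>The first level\<close>

lemma singleton_in_words: "[x] \<in> words X 1 \<longleftrightarrow> x \<in> X"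
  by (simp add: words_def)

lemma level_1: "level R 1 ([x], [y]) = ([fst (R (x, y))], [snd (R (x, y))])"
  by (simp add: level_eq)

lemma nondegenerate_of_level_1:
  assumes "finite X" and im: "R ` (X \<times> X) \<subseteq> X \<times> X"
    and nd: "nondegenerate (words X 1) (level R 1)"
  shows "nondegenerate X R"
proof -
  have snd_inj: "inj_on (\<lambda>u. snd (level R 1 (u, [y]))) (words X 1)"
    and fst_inj: "inj_on (\<lambda>v. fst (level R 1 ([y], v))) (words X 1)" if "y \<in> X" for y
    using nd that
    unfolding nondegenerate_iff_inj[OF finite_words[OF assms(1)] level_closed[OF im]]
    by (auto simp: singleton_in_words[of y X, symmetric])
  show ?thesis
    unfolding nondegenerate_iff_inj[OF assms(1,2)]
  proof (intro conjI ballI inj_onI)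
    fix y x x' assume "y \<in> X" "x \<in> X" "x' \<in> X" "snd (R (x, y)) = snd (R (x', y))"
    then show "x = x'"
      using inj_onD[OF snd_inj, of y "[x]" "[x']"] by (simp add: level_1[simplified] words_def)
  next
    fix y x x' assume "y \<in> X" "x \<in> X" "x' \<in> X" "fst (R (y, x)) = fst (R (y, x'))"
    then show "x = x'"
      using inj_onD[OF fst_inj, of y "[x]" "[x']"] by (simp add: level_1[simplified] words_def)
  qed
qed

lemma yb_solution_of_level_1:
  assumes "bij_betw R (X \<times> X) (X \<times> X)" and yb: "yb_solution (words X 1) (level R 1)"
  shows "yb_solution X R"
proof -
  have "yb_words R [x] [y] [z]" if "x \<in> X" "y \<in> X" "z \<in> X" for x y z
    using yb that level_yb_iff[of "[x]" X 1 "[y]" "[z]" R]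
    unfolding yb_solution_def by (simp add: singleton_in_words del: One_nat_def o_apply)
  then show ?thesis
    using assms(1) by (simp add: yb_solution_def yb_words_letters del: o_apply)
qed

theorem proposition6p5:
  fixes X :: "'a set" and R :: "'a \<times> 'a \<Rightarrow> 'a \<times> 'a"
  assumes "finite X" and "X \<noteq> {}"
    and "bij_betw R (X \<times> X) (X \<times> X)"
  shows "(nondegenerate X R \<longleftrightarrow> (\<forall>n\<ge>1. nondegenerate (words X n) (level R n))) \<and>
    (yb_solution X R \<and> nondegenerate X R \<longleftrightarrow>
      (\<forall>n\<ge>1. yb_solution (words X n) (level R n) \<and> nondegenerate (words X n) (level R n)))"
proof -
  have im: "R ` (X \<times> X) \<subseteq> X \<times> X"
    using assms(3) by (simp add: bij_betw_def)
  show ?thesis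
    using nondegenerate_level[OF assms(1) im] nondegenerate_of_level_1[OF assms(1) im]
      yb_solution_level[OF assms(1)] yb_solution_of_level_1[OF assms(3)]
    by blast
qed

end
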